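(* Let $f:\mathbb R\to\mathbb R$ be smooth, let $I=[a,b]\subset\mathbb R$, and let $L\in\mathbb R$ satisfy $\tilde I:=I+L=[a+L,b+L]\subset(0,\infty)$. Let $F(\sigma)=\dfrac{f(\sigma-L)}{\sigma}$ and suppose $F'(\sigma)=0$ for some $\sigma\in\tilde I$. For a constant $K\in\mathbb R$ define $$g(\sigma)=f(\sigma-L)+K,\qquad G(\sigma)=\frac{g(\sigma)}{\sigma}.$$ If $K<\min\limits_{\sigma\in\tilde I}\{\sigma f'(\sigma-L)-f(\sigma-L)\}$, then $G'(\sigma)>0$ for all $\sigma\in\tilde I$ and $G$ is invertible on $\tilde I$. Moreover, the system $$\eta_t-G\left(\frac v\eta\right)_x=0,\qquad v_t=0$$ is strictly hyperbolic on the set of states $\{(\eta,v)\in\mathbb R^2:\eta>0,\ v/\eta\in\tilde I\}$.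
   Context: A $2\times2$ system $w_t+P(w)_x=0$ is strictly hyperbolic on a set of states if at each state of the set the Jacobian matrix $DP(w)$ has two distinct real eigenvalues. Here $w=(\eta,v)$ and $P(w)=(-G(v/\eta),0)$. "$G$ is invertible on $\tilde I$" means $G:\tilde I\to G(\tilde I)$ is a bijection. *)

theory Defs
  imports "HOL-Analysis.Analysis"
begin

definition smooth_fun :: "(real \<Rightarrow> real) \<Rightarrow> bool" where
  "smooth_fun f \<longleftrightarrow> (\<forall>n x. (deriv ^^ n) f differentiable (at x))"

definition real_eigenvalue :: "real ^ 'n ^ 'n \<Rightarrow> real \<Rightarrow> bool" where
  "real_eigenvalue A l \<longleftrightarrow> (\<exists>u. u \<noteq> 0 \<and> A *v u = l *\<^sub>R u)"

text \<open>
  A 2 x 2 system of conservation laws w_t + P(w)_x = 0 is represented by its flux P.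
  Differentiability of P is demanded explicitly because the library's \<open>jacobian\<close> is an
  unspecified matrix at points where P is not differentiable.
\<close>
definition strictly_hyperbolic_on :: "(real ^ 2 \<Rightarrow> real ^ 2) \<Rightarrow> (real ^ 2) set \<Rightarrow> bool" where
  "strictly_hyperbolic_on P S \<longleftrightarrow>
     (\<forall>w\<in>S. P differentiable (at w) \<and>
        (\<exists>l1 l2. l1 \<noteq> l2 \<and> real_eigenvalue (jacobian P (at w)) l1
                        \<and> real_eigenvalue (jacobian P (at w)) l2))"

end

theory Submission
  imports Defs
begin

text \<open>By the quotient rule, \<open>G'\<close> at \<sigma> is (h(\<sigma>) - K) / \<sigma>^2,
  where h(\<sigma>) = \<sigma> f'(\<sigma> - L) - f(\<sigma> - L). The bound on \<open>K\<close>
  says exactly that \<open>K\<close> lies below the minimum of h over \<open>J\<close>, so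
  \<open>G'\<close> is positive there; since \<open>J\<close> is an interval, \<open>G\<close> is
  strictly increasing and hence injective on it. The flux has constant second component, so its
  Jacobian has zero second row and eigenvalues 0 and G'(v/\<eta>) v/\<eta>^2. These differ because
  \<open>G'\<close> and v are both nonzero on the given states
  (\<open>strictly_hyperbolic_on_ratio_flux\<close>).\<close>

lemma smooth_fun_has_real_derivative:
  assumes "smooth_fun f"
  shows "(f has_real_derivative deriv f x) (at x)"
proof -
  have "(deriv ^^ 0) f differentiable (at x)"
    using assms unfolding smooth_fun_def by blast
  then show ?thesis
    by (simp add: DERIV_deriv_iff_real_differentiable)
qed

lemma smooth_fun_isCont_deriv:
  assumes "smooth_fun f"
  shows "isCont (deriv f) x"
proof -
  have "(deriv ^^ 1) f differentiable (at x)"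
    using assms unfolding smooth_fun_def by blast
  then show ?thesis
    by (simp add: differentiable_imp_continuous_within)
qed

text \<open>On the reals, \<open>LEAST\<close> is informative only when the minimum is attained;
  compactness and continuity provide this, so the \<open>LEAST\<close> term is a true lower
  bound.\<close>

lemma Least_image_compact_le:
  fixes h :: "'a::topological_space \<Rightarrow> real"
  assumes "compact S" "continuous_on S h" "x \<in> S"
  shows "(LEAST m. m \<in> h ` S) \<le> h x"
proof -
  obtain y where y: "y \<in> S" "\<And>z. z \<in> S \<Longrightarrow> h y \<le> h z"
    using continuous_attains_inf[OF assms(1) _ assms(2)] assms(3) by blast
  have "(LEAST m. m \<in> h ` S) = h y"
    using y by (intro Least_equality) auto
  with y(2) assms(3) show ?thesis by simp
qed

lemma pos_deriv_imp_inj_on_Icc: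
  fixes G :: "real \<Rightarrow> real"
  assumes "\<And>x. x \<in> {a..b} \<Longrightarrow> (G has_real_derivative G' x) (at x) \<and> G' x > 0"
  shows "inj_on G {a..b}"
proof (rule linorder_inj_onI')
  fix x y assume xy: "x \<in> {a..b}" "y \<in> {a..b}" "x < y"
  have "G x < G y"
  proof (rule DERIV_pos_imp_increasing[OF xy(3)])
    fix z assume "x \<le> z" "z \<le> y"
    then show "\<exists>l. DERIV G z :> l \<and> l > 0"
      using assms[of z] xy by (intro exI[of _ "G' z"]) simp
  qed
  then show "G x \<noteq> G y" by simp
qed

text \<open>Allows eigenvector equations to be checked on the derivative as a linear map, with no
  computation of matrix entries.\<close>

lemma jacobian_mult_vec:
  fixes P :: "real ^ 'n \<Rightarrow> real ^ 'm"
  assumes "(P has_derivative D) (at w)"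
  shows "jacobian P (at w) *v h = D h"
  unfolding jacobian_def frechet_derivative_at[OF assms, symmetric]
  using has_derivative_linear[OF assms]
  by (simp add: matrix_works linear_matrix_vector_mul_eq)

text \<open>Quotient rule followed by the chain rule. In this form the numerator visibly vanishes at
  h = w, and at h = (1, 0) the value is a multiple of h.\<close>

lemma has_derivative_ratio_flux:
  fixes G :: "real \<Rightarrow> real" and w :: "real ^ 2"
  assumes G: "(G has_real_derivative c) (at (w $ 2 / w $ 1))" and "w $ 1 \<noteq> 0"
  shows "((\<lambda>w. vector [- G (w $ 2 / w $ 1), 0]) has_derivative
           (\<lambda>h. vector [c * (w $ 2 * h $ 1 - w $ 1 * h $ 2) / (w $ 1)\<^sup>2, 0] :: real ^ 2)) (at w)"
proof -
  have nth: "((\<lambda>w :: real ^ 2. w $ i) has_derivative (\<lambda>h. h $ i)) (at w)" for i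
    by (intro bounded_linear_imp_has_derivative bounded_linear_vec_nth)
  \<comment> \<open>The flux is a scalar function times a fixed vector, so differentiating the
    scalar factor suffices.\<close>
  have vec: "vector [x, 0] = x *\<^sub>R (axis 1 1 :: real ^ 2)" for x :: real
    by (simp add: vec_eq_iff forall_2 axis_def)
  have "((\<lambda>w. w $ 2 / w $ 1) has_derivative
          (\<lambda>h. (h $ 2 * w $ 1 - w $ 2 * h $ 1) / (w $ 1 * w $ 1))) (at w)"
    by (rule has_derivative_divide'[OF nth nth assms(2)])
  from has_derivative_compose[OF this G[unfolded has_field_derivative_def]]
  have "((\<lambda>w. - G (w $ 2 / w $ 1)) has_derivative
          (\<lambda>h. - (c * ((h $ 2 * w $ 1 - w $ 2 * h $ 1) / (w $ 1 * w $ 1))))) (at w)"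
    by (rule has_derivative_minus)
  then have "((\<lambda>w. - G (w $ 2 / w $ 1)) has_derivative
          (\<lambda>h. c * (w $ 2 * h $ 1 - w $ 1 * h $ 2) / (w $ 1)\<^sup>2)) (at w)"
    by (rule has_derivative_eq_rhs) (simp add: fun_eq_iff power2_eq_square divide_inverse algebra_simps)
  then show ?thesis
    unfolding vec by (rule has_derivative_scaleR_left)
qed

text \<open>
  The state \<open>w\<close> itself is a null vector of the Jacobian, because the flux is constant along
  rays; the first coordinate axis is an eigenvector for \<open>G'(w\<^sub>2/w\<^sub>1) w\<^sub>2/w\<^sub>1\<^sup>2\<close>.
\<close>
lemma strictly_hyperbolic_on_ratio_flux:
  fixes G :: "real \<Rightarrow> real"
  assumes "\<And>w. w \<in> S \<Longrightarrow> w $ 1 \<noteq> 0 \<and> w $ 2 \<noteq> 0"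
    and "\<And>w. w \<in> S \<Longrightarrow> \<exists>c. c \<noteq> 0 \<and> (G has_real_derivative c) (at (w $ 2 / w $ 1))"
  shows "strictly_hyperbolic_on (\<lambda>w. vector [- G (w $ 2 / w $ 1), 0]) S"
  unfolding strictly_hyperbolic_on_def
proof (intro ballI conjI)
  fix w :: "real ^ 2" assume "w \<in> S"
  then obtain c where w: "w $ 1 \<noteq> 0" "w $ 2 \<noteq> 0" and c: "c \<noteq> 0"
    and "(G has_real_derivative c) (at (w $ 2 / w $ 1))"
    using assms by blast
  note D = has_derivative_ratio_flux[OF this(4) w(1)]
  let ?P = "\<lambda>w :: real ^ 2. vector [- G (w $ 2 / w $ 1), 0] :: real ^ 2"
  show "?P differentiable (at w)"
    using D unfolding differentiable_def by blast
  have "real_eigenvalue (jacobian ?P (at w)) 0"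
    unfolding real_eigenvalue_def jacobian_mult_vec[OF D] using w
    by (intro exI[of _ w]) (auto simp: vec_eq_iff forall_2)
  moreover have "real_eigenvalue (jacobian ?P (at w)) (c * w $ 2 / (w $ 1)\<^sup>2)"
    unfolding real_eigenvalue_def jacobian_mult_vec[OF D]
    by (intro exI[of _ "vector [1, 0]"]) (auto simp: vec_eq_iff forall_2)
  moreover have "0 \<noteq> c * w $ 2 / (w $ 1)\<^sup>2"
    using w c by simp
  ultimately show "\<exists>l1 l2. l1 \<noteq> l2 \<and> real_eigenvalue (jacobian ?P (at w)) l1
      \<and> real_eigenvalue (jacobian ?P (at w)) l2"
    by blast
qed

theorem lemma2p1:
  fixes f F g G :: "real \<Rightarrow> real" and a b L K :: real and I J :: "real set"
  assumes "smooth_fun f"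
    and "I = {a..b}"
    and "J = (\<lambda>x. x + L) ` I"
    and "J \<subseteq> {0<..}"
    and "F = (\<lambda>\<sigma>. f (\<sigma> - L) / \<sigma>)"
    and "\<exists>\<sigma>\<in>J. (F has_real_derivative 0) (at \<sigma>)"
    and "g = (\<lambda>\<sigma>. f (\<sigma> - L) + K)"
    and "G = (\<lambda>\<sigma>. g \<sigma> / \<sigma>)"
    and "K < (LEAST m. m \<in> (\<lambda>\<sigma>. \<sigma> * deriv f (\<sigma> - L) - f (\<sigma> - L)) ` J)"
  shows "(\<forall>\<sigma>\<in>J. G differentiable (at \<sigma>) \<and> deriv G \<sigma> > 0)
       \<and> bij_betw G J (G ` J)
       \<and> strictly_hyperbolic_on
           (\<lambda>w. vector [- G (w $ 2 / w $ 1), 0])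
           {w. w $ 1 > 0 \<and> w $ 2 / w $ 1 \<in> J}"
proof -
  define h where "h = (\<lambda>\<sigma>. \<sigma> * deriv f (\<sigma> - L) - f (\<sigma> - L))"
  \<comment> \<open>The quotient rule numerator \<sigma> g'(\<sigma>) - g(\<sigma>) equals
    h(\<sigma>) - K, since the constant \<open>K\<close> in \<open>g\<close> survives only in the
    second term.\<close>
  define G' where "G' = (\<lambda>\<sigma>. (h \<sigma> - K) / \<sigma>\<^sup>2)"
  note f' = smooth_fun_has_real_derivative[OF assms(1)]
  have J: "J = {a + L..b + L}"
    using assms(2,3) by (simp add: add.commute)
  have pos: "\<sigma> > 0" if "\<sigma> \<in> J" for \<sigma>
    using that assms(4) by auto
  \<comment> \<open>Smoothness beyond the first derivative enters here: \<open>deriv f\<close> has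
    to be continuous for the minimum of \<open>h\<close> over the compact \<open>J\<close> to be
    attained.\<close>
  have "isCont h \<sigma>" for \<sigma>
    unfolding h_def
    using isCont_o2[OF _ smooth_fun_isCont_deriv[OF assms(1)], of \<sigma> "\<lambda>\<sigma>. \<sigma> - L"]
      isCont_o2[OF _ DERIV_isCont[OF f'], of \<sigma> "\<lambda>\<sigma>. \<sigma> - L"]
    by (intro continuous_intros) simp_all
  then have "continuous_on J h"
    by (simp add: continuous_at_imp_continuous_on)
  then have K: "K < h \<sigma>" if "\<sigma> \<in> J" for \<sigma>
    using Least_image_compact_le[of J h \<sigma>] that assms(9) J unfolding h_def by simp
  have G': "(G has_real_derivative G' \<sigma>) (at \<sigma>) \<and> G' \<sigma> > 0" if "\<sigma> \<in> J" for \<sigma>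
  proof
    have "((\<lambda>\<sigma>. \<sigma> - L) has_real_derivative 1) (at \<sigma>)"
      by (auto intro!: derivative_eq_intros)
    from DERIV_chain2[OF f' this]
    have "((\<lambda>\<sigma>. f (\<sigma> - L)) has_real_derivative deriv f (\<sigma> - L)) (at \<sigma>)"
      by simp
    then show "(G has_real_derivative G' \<sigma>) (at \<sigma>)"
      unfolding assms(7,8) G'_def h_def using pos[OF that]
      by (auto intro!: derivative_eq_intros simp: power2_eq_square field_simps)
    show "G' \<sigma> > 0"
      using K[OF that] pos[OF that] by (simp add: G'_def)
  qed
  have "G differentiable (at \<sigma>) \<and> deriv G \<sigma> > 0" if "\<sigma> \<in> J" for \<sigma>
    using G'[OF that] DERIV_imp_deriv real_differentiable_def by metis
  moreover have "bij_betw G J (G ` J)"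
    using pos_deriv_imp_inj_on_Icc[of "a + L" "b + L" G G'] G' J
    by (simp add: inj_on_imp_bij_betw)
  moreover have "strictly_hyperbolic_on (\<lambda>w. vector [- G (w $ 2 / w $ 1), 0])
           {w. w $ 1 > 0 \<and> w $ 2 / w $ 1 \<in> J}"
  proof (rule strictly_hyperbolic_on_ratio_flux)
    fix w :: "real ^ 2" assume w: "w \<in> {w. w $ 1 > 0 \<and> w $ 2 / w $ 1 \<in> J}"
    \<comment> \<open>Positivity of \<open>J\<close> excludes a zero ratio, hence a zero second
      coordinate, where the two eigenvalues would coincide.\<close>
    then show "w $ 1 \<noteq> 0 \<and> w $ 2 \<noteq> 0"
      using pos[of "w $ 2 / w $ 1"] by auto
    show "\<exists>c. c \<noteq> 0 \<and> (G has_real_derivative c) (at (w $ 2 / w $ 1))"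
      using G'[of "w $ 2 / w $ 1"] w by (intro exI[of _ "G' (w $ 2 / w $ 1)"]) auto
  qed
  ultimately show ?thesis by blast
qed

end
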